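(* Suppose the behavior policy has the form $\pi_t(a\mid X_t,\mathcal H_{t-1})=\pi(a\mid X_t,\hat\beta_{t-1})$ for a fixed function $\pi:\mathcal X\times\mathbb R^{d_\beta}\to\Delta(\mathcal A)$, where $\hat\beta_{t-1}\in\mathbb R^{d_\beta}$ is an $\mathcal H_{t-1}$-measurable random vector. Let $a\in\mathcal A$ and suppose that (i) $\hat\beta_t\xrightarrow{p}\beta^*$ for some $\beta^*\in\mathbb R^{d_\beta}$; (ii) $\pi(a\mid X_t,\cdot)$ is continuous at $\beta^*$ for a.e. $X_t$ (with respect to the distribution of $X_t$). Then the behavior policy converges at action $a$ with limit policy $\bar\pi(a\mid x)=\pi(a\mid x,\beta^* )$, i.e. $\pi_t(a\mid X_t,\mathcal H_{t-1})-\bar\pi(a\mid X_t)\xrightarrow{p}0$ as $t\to\infty$.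
   Context: Contextual bandit setting. Contexts $X_t\in\mathcal X\subseteq\mathbb R^{d_X}$, finite action set $\mathcal A=\{1,\dots,K\}$, potential outcomes $Y_t(a)\in\mathbb R$; the tuples $(X_t,\{Y_t(a)\}_{a\in\mathcal A})$, $t\ge1$, are i.i.d. At time $t$, given the history $\mathcal H_{t-1}=\{X_\tau,\pi_\tau,A_\tau,Y_\tau\}_{\tau<t}$ and $X_t$, the action $A_t$ is drawn from the behavior policy $\pi_t(\cdot\mid X_t,\mathcal H_{t-1})\in\Delta(\mathcal A)$ (probability distributions on $\mathcal A$), and the outcome $Y_t=Y_t(A_t)$ is observed. *)

theory Defs
  imports "HOL-Probability.Probability"
begin

definition tendsto_in_prob ::
  "'w measure \<Rightarrow> (nat \<Rightarrow> 'w \<Rightarrow> 'b::metric_space) \<Rightarrow> ('w \<Rightarrow> 'b) \<Rightarrow> bool"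
where
  "tendsto_in_prob M Z W \<longleftrightarrow>
     (\<forall>\<epsilon>>0. (\<lambda>t. measure M {\<omega> \<in> space M. dist (Z t \<omega>) (W \<omega>) > \<epsilon>}) \<longlonglongrightarrow> 0)"

definition observed_outcome ::
  "(nat \<Rightarrow> nat \<Rightarrow> 'w \<Rightarrow> real) \<Rightarrow> (nat \<Rightarrow> 'w \<Rightarrow> nat) \<Rightarrow> nat \<Rightarrow> 'w \<Rightarrow> real"
where
  "observed_outcome Y A t \<omega> = Y t (A t \<omega>) \<omega>"

definition context_space :: "(real ^ 'dx) set \<Rightarrow> (real ^ 'dx) measure" where
  "context_space \<X> = restrict_space borel \<X>"

definition tuple_space ::
  "(real ^ 'dx) set \<Rightarrow> nat \<Rightarrow> ((real ^ 'dx) \<times> (nat \<Rightarrow> real)) measure"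
where
  "tuple_space \<X> K = context_space \<X> \<Otimes>\<^sub>M (\<Pi>\<^sub>M a\<in>{1..K}. borel)"

definition tuple ::
  "nat \<Rightarrow> (nat \<Rightarrow> 'w \<Rightarrow> real ^ 'dx) \<Rightarrow> (nat \<Rightarrow> nat \<Rightarrow> 'w \<Rightarrow> real)
   \<Rightarrow> nat \<Rightarrow> 'w \<Rightarrow> (real ^ 'dx) \<times> (nat \<Rightarrow> real)"
where
  "tuple K X Y t \<omega> = (X t \<omega>, \<lambda>a\<in>{1..K}. Y t a \<omega>)"

text \<open>
  A behavior policy is a family of random kernels: \<open>\<pi>\<^sub>b t \<omega> x\<close> is the distribution on actions
  that \<open>\<pi>\<^sub>t(\<cdot> | x, H\<^sub>t\<^sub>-\<^sub>1)\<close> denotes when \<open>\<omega>\<close> is the outcome. The argument \<open>s\<close> of the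
  \<open>\<sigma>\<close>-algebra \<open>history\<close> is the last round included, so \<open>history \<dots> 0\<close> is trivial and the history
  available before round \<open>t\<close> is \<open>history \<dots> (t - 1)\<close>. The kernels themselves belong to the
  history; they enter through their values at all contexts and actions.
\<close>

definition history ::
  "'w measure \<Rightarrow> (real ^ 'dx) set \<Rightarrow> nat \<Rightarrow> (nat \<Rightarrow> 'w \<Rightarrow> real ^ 'dx)
   \<Rightarrow> (nat \<Rightarrow> nat \<Rightarrow> 'w \<Rightarrow> real) \<Rightarrow> (nat \<Rightarrow> 'w \<Rightarrow> nat)
   \<Rightarrow> (nat \<Rightarrow> 'w \<Rightarrow> real ^ 'dx \<Rightarrow> nat pmf) \<Rightarrow> nat \<Rightarrow> 'w measure"
where
  "history M \<X> K X Y A \<pi>\<^sub>b s =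
     sigma (space M)
       (\<Union>\<tau>\<in>{1..s}.
          sets (vimage_algebra (space M) (X \<tau>) (context_space \<X>))
        \<union> (\<Union>x\<in>\<X>. \<Union>a\<in>{1..K}.
             sets (vimage_algebra (space M) (\<lambda>\<omega>. pmf (\<pi>\<^sub>b \<tau> \<omega> x) a) borel))
        \<union> sets (vimage_algebra (space M) (A \<tau>) (count_space {1..K}))
        \<union> sets (vimage_algebra (space M) (observed_outcome Y A \<tau>) borel))"

definition history_and_context ::
  "'w measure \<Rightarrow> (real ^ 'dx) set \<Rightarrow> nat \<Rightarrow> (nat \<Rightarrow> 'w \<Rightarrow> real ^ 'dx)
   \<Rightarrow> (nat \<Rightarrow> nat \<Rightarrow> 'w \<Rightarrow> real) \<Rightarrow> (nat \<Rightarrow> 'w \<Rightarrow> nat)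
   \<Rightarrow> (nat \<Rightarrow> 'w \<Rightarrow> real ^ 'dx \<Rightarrow> nat pmf) \<Rightarrow> nat \<Rightarrow> 'w measure"
where
  "history_and_context M \<X> K X Y A \<pi>\<^sub>b t =
     sigma (space M)
       (sets (history M \<X> K X Y A \<pi>\<^sub>b (t - 1))
        \<union> sets (vimage_algebra (space M) (X t) (context_space \<X>)))"

text \<open>
  Rounds are numbered from 1; values at \<open>t = 0\<close> are unconstrained. In \<open>action_drawn\<close>, the
  conditional probability of \<open>A t = a\<close> given \<open>H\<^sub>t\<^sub>-\<^sub>1\<close> and \<open>X t\<close> is prescribed; no
  independence of \<open>A t\<close> from the potential outcomes is imposed.
\<close>

locale contextual_bandit = prob_space M
  for M :: "'w measure" +
  fixes \<X> :: "(real ^ 'dx) set"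
    and K :: nat
    and X :: "nat \<Rightarrow> 'w \<Rightarrow> real ^ 'dx"
    and Y :: "nat \<Rightarrow> nat \<Rightarrow> 'w \<Rightarrow> real"
    and A :: "nat \<Rightarrow> 'w \<Rightarrow> nat"
    and \<pi>\<^sub>b :: "nat \<Rightarrow> 'w \<Rightarrow> real ^ 'dx \<Rightarrow> nat pmf"
  assumes tuples_indep:
      "indep_vars (\<lambda>_. tuple_space \<X> K) (tuple K X Y) {1..}"
    and tuples_identically_distributed:
      "\<And>t. t \<ge> 1 \<Longrightarrow>
         distr M (tuple_space \<X> K) (tuple K X Y t) = distr M (tuple_space \<X> K) (tuple K X Y 1)"
    and behavior_policy_on_actions:
      "\<And>t \<omega> x. t \<ge> 1 \<Longrightarrow> \<omega> \<in> space M \<Longrightarrow> x \<in> \<X> \<Longrightarrow> set_pmf (\<pi>\<^sub>b t \<omega> x) \<subseteq> {1..K}"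
    and behavior_policy_depends_on_history:
      "\<And>t a. t \<ge> 1 \<Longrightarrow> a \<in> {1..K} \<Longrightarrow>
         (\<lambda>(\<omega>, x). pmf (\<pi>\<^sub>b t \<omega> x) a)
           \<in> borel_measurable (history M \<X> K X Y A \<pi>\<^sub>b (t - 1) \<Otimes>\<^sub>M context_space \<X>)"
    and action_measurable:
      "\<And>t. t \<ge> 1 \<Longrightarrow> A t \<in> M \<rightarrow>\<^sub>M count_space {1..K}"
    and action_drawn:
      "\<And>t a. t \<ge> 1 \<Longrightarrow> a \<in> {1..K} \<Longrightarrow>
         AE \<omega> in M.
           real_cond_exp M (history_and_context M \<X> K X Y A \<pi>\<^sub>b t)
             (indicator {\<omega>' \<in> space M. A t \<omega>' = a}) \<omega>
           = pmf (\<pi>\<^sub>b t \<omega> (X t \<omega>)) a"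

text \<open>
  A policy \<open>\<pi>(\<cdot> | x, \<beta>)\<close> in \<open>\<Delta>({1..K})\<close>, parametrized by \<open>\<beta>\<close>. Joint Borel measurability is
  what makes \<open>\<pi>(a | X\<^sub>t, \<beta>)\<close> a random variable for random \<open>\<beta>\<close>.
\<close>

definition parametric_policy ::
  "(real ^ 'dx) set \<Rightarrow> nat \<Rightarrow> (real ^ 'dx \<Rightarrow> real ^ 'db \<Rightarrow> nat pmf) \<Rightarrow> bool"
where
  "parametric_policy \<X> K \<pi> \<longleftrightarrow>
     (\<forall>x\<in>\<X>. \<forall>\<beta>. set_pmf (\<pi> x \<beta>) \<subseteq> {1..K}) \<and>
     (\<forall>a\<in>{1..K}. (\<lambda>(x, \<beta>). pmf (\<pi> x \<beta>) a) \<in> borel_measurable (context_space \<X> \<Otimes>\<^sub>M borel))"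

definition behavior_policy_converges_at ::
  "'w measure \<Rightarrow> (nat \<Rightarrow> 'w \<Rightarrow> real ^ 'dx) \<Rightarrow> (nat \<Rightarrow> 'w \<Rightarrow> real ^ 'dx \<Rightarrow> nat pmf)
   \<Rightarrow> nat \<Rightarrow> (real ^ 'dx \<Rightarrow> nat pmf) \<Rightarrow> bool"
where
  "behavior_policy_converges_at M X \<pi>\<^sub>b a \<pi>_lim \<longleftrightarrow>
     tendsto_in_prob M (\<lambda>t \<omega>. pmf (\<pi>\<^sub>b t \<omega> (X t \<omega>)) a - pmf (\<pi>_lim (X t \<omega>)) a) (\<lambda>_. 0)"

end

(* Nothing makes X_t independent of the history, because A_t may depend on later tuples; so one cannot
   condition on the history and integrate out X_t. Put f x b = pi(a|x,b). One needs uniformity in x, but the sets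
   {x. exists b near beta*, |f x b - f x beta*| > eps} are only projections of Borel sets. Inner
   regularity of the law of (X_t, beta_t) replaces each of them by the projection of a compact set,
   which is closed. If the probabilities did not tend to 0, the projections obtained along a
   subsequence of rounds would all have mass at least c > 0 under the common law of the contexts, so
   their limsup would have mass at least c as well. But f x is discontinuous at beta* at each of its
   points x. *)
theory Submission
  imports Defs
begin

text \<open>A reverse Fatou inequality for sets: each tail union contains one of the sets, and the
  tail unions decrease to the limsup, so continuity from above applies in a finite measure.\<close>

lemma (in finite_measure) measure_limsup_ge:
  assumes G: "\<And>k. G k \<in> sets M" and c: "\<And>k::nat. c \<le> measure M (G k)"
  shows "c \<le> measure M (\<Inter>m. \<Union>k\<in>{m..}. G k)"
proof -
  let ?U = "\<lambda>m. \<Union>k\<in>{m..}. G k"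
  have U: "?U m \<in> sets M" for m
    using G by auto
  have "(\<lambda>m. measure M (?U m)) \<longlonglongrightarrow> measure M (\<Inter>m. ?U m)"
    using U by (intro finite_Lim_measure_decseq) (auto simp: decseq_def, force)
  moreover have "c \<le> measure M (?U m)" for m
    using c[of m] finite_measure_mono[OF _ U, of "G m" m] by fastforce
  ultimately show ?thesis
    by (intro LIMSEQ_le_const) auto
qed

lemma inner_regular_measure:
  fixes N :: "'a::{second_countable_topology, complete_space} measure"
  assumes N: "finite_measure N" "sets N = sets borel"
    and B: "B \<in> sets borel" and c: "c < measure N B"
  obtains C where "C \<subseteq> B" "compact C" "c < measure N C"
\<comment> \<open>The case split is forced by \<open>ennreal\<close>, which truncates a negative
  \<open>c\<close> to 0 and would lose the strict inequality when \<open>B\<close> is null.\<close>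
proof (cases "c < 0")
  case True
  then show ?thesis
    using that[of "{}"] by simp
next
  case False
  interpret finite_measure N by fact
  have "ennreal c < emeasure N B"
    using c False by (simp add: emeasure_eq_measure ennreal_lessI)
  also have "emeasure N B = (SUP C\<in>{C. C \<subseteq> B \<and> compact C}. emeasure N C)"
    using N B by (intro inner_regular) (auto simp: emeasure_eq_measure)
  finally obtain C where "C \<subseteq> B" "compact C" "ennreal c < emeasure N C"
    by (auto simp: less_SUP_iff)
  with False show ?thesis
    by (intro that[of C]) (auto simp: emeasure_eq_measure ennreal_less_iff)
qed

text \<open>\<open>S\<close> need not be Borel. This lemma moves events from the trace of the Borel
  sets to the whole product, where inner regularity is available.\<close>

lemma sets_pair_restrict_borel_extend:
  fixes S :: "'a::second_countable_topology set"
    and E :: "('a \<times> 'b::second_countable_topology) set"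
  assumes "E \<in> sets (restrict_space borel S \<Otimes>\<^sub>M borel)"
  obtains B where "B \<in> sets borel" "E = B \<inter> S \<times> UNIV"
proof -
  let ?R = "restrict_space (borel \<Otimes>\<^sub>M borel) (S \<times> UNIV) :: ('a \<times> 'b) measure"
  \<comment> \<open>This is the identity map, split into coordinates so that its measurability can
    be checked componentwise.\<close>
  have "(\<lambda>p. (fst p, snd p)) \<in> ?R \<rightarrow>\<^sub>M restrict_space borel S \<Otimes>\<^sub>M borel"
    by (intro measurable_Pair measurable_restrict_space2 measurable_restrict_space1)
       (auto simp: space_restrict_space space_pair_measure)
  from measurable_sets[OF this assms] have "E \<inter> S \<times> UNIV \<in> sets ?R"
    by (simp add: space_restrict_space space_pair_measure)
  moreover have "E \<subseteq> S \<times> UNIV"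
    using sets.sets_into_space[OF assms] by (simp add: space_restrict_space space_pair_measure)
  ultimately show ?thesis
    using that by (auto simp: sets_restrict_space borel_prod Int_absorb2 Int_commute)
qed

text \<open>A continuous mapping theorem for a random function. The modulus of continuity at \<beta>
  may vary with the context, and the joint law of \<open>X n\<close> and \<open>b n\<close> is
  arbitrary.\<close>

lemma (in prob_space) tendsto_in_prob_isCont:
  fixes S :: "'x::{second_countable_topology, complete_space} set"
    and X :: "nat \<Rightarrow> 'a \<Rightarrow> 'x" and b :: "nat \<Rightarrow> 'a \<Rightarrow> 'b::{second_countable_topology, complete_space}"
    and f :: "'x \<Rightarrow> 'b \<Rightarrow> 'c::{second_countable_topology, real_normed_vector}"
  assumes X[measurable]: "\<And>n. X n \<in> M \<rightarrow>\<^sub>M restrict_space borel S"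
    and distr_X: "\<And>n. distr M (restrict_space borel S) (X n) = distr M (restrict_space borel S) (X 0)"
    and b[measurable]: "\<And>n. b n \<in> borel_measurable M"
    and f[measurable]: "case_prod f \<in> borel_measurable (restrict_space borel S \<Otimes>\<^sub>M borel)"
    and consistent: "tendsto_in_prob M b (\<lambda>_. \<beta>)"
    and cont: "AE \<omega> in M. isCont (f (X 0 \<omega>)) \<beta>"
  shows "tendsto_in_prob M (\<lambda>n \<omega>. f (X n \<omega>) (b n \<omega>) - f (X n \<omega>) \<beta>) (\<lambda>_. 0)"
proof (rule ccontr)
  let ?R = "restrict_space borel S"
  have X_in: "X n \<omega> \<in> S" if "\<omega> \<in> space M" for n \<omega>
    using measurable_space[OF X that] by (simp add: space_restrict_space)
  have X_borel[measurable]: "X n \<in> borel_measurable M" for n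
    using X[of n] by (simp add: measurable_restrict_space2_iff)
  assume "\<not> ?thesis"
  then obtain \<epsilon> where "\<epsilon> > 0" and
    "\<not> (\<lambda>n. prob {\<omega> \<in> space M. norm (f (X n \<omega>) (b n \<omega>) - f (X n \<omega>) \<beta>) > \<epsilon>}) \<longlonglongrightarrow> 0"
    (is "\<not> (\<lambda>n. prob (?D n)) \<longlonglongrightarrow> 0")
    by (auto simp: tendsto_in_prob_def)
  then obtain d where "d > 0" and d: "\<And>m. \<exists>n\<ge>m. d \<le> prob (?D n)"
    unfolding LIMSEQ_iff by (auto simp: not_less)
  \<comment> \<open>One half of \<open>d\<close> pays for the event that \<open>b n\<close> is far
    from \<beta>; the other half is the mass that must survive.\<close>
  define c where "c = d / 2"
  have "c > 0" and far: "\<And>m. \<exists>n\<ge>m. 2 * c \<le> prob (?D n)"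
    using \<open>d > 0\<close> d by (simp_all add: c_def)
  \<comment> \<open>The bad pairs at scale \<open>k\<close>. The non-strict distance bound
    complements the strict one in \<open>?N\<close> below, so \<open>?D n\<close> is covered by
    \<open>?N n\<close> and the event that the pair lies in \<open>E k\<close>.\<close>
  define E where "E k = {p \<in> space (?R \<Otimes>\<^sub>M borel).
    norm (case_prod f p - f (fst p) \<beta>) > \<epsilon> \<and> dist (snd p) \<beta> \<le> inverse (real (Suc k))}" for k
  have E: "E k \<in> sets (?R \<Otimes>\<^sub>M borel)" for k
  proof -
    have [measurable]: "(\<lambda>p. f (fst p) \<beta>) \<in> borel_measurable (?R \<Otimes>\<^sub>M borel)"
      using measurable_compose[OF _ f, of "\<lambda>p. (fst p, \<beta>)" "?R \<Otimes>\<^sub>M borel"] by simp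
    show ?thesis
      unfolding E_def by measurable
  qed
  \<comment> \<open>The round \<open>n\<close> may depend on \<open>k\<close>: it must be late
    enough for consistency at scale \<open>k\<close> and be one of the rounds where
    \<open>?D n\<close> is large.\<close>
  have "\<exists>G n. G \<in> sets borel \<and> c \<le> prob (X n -` G \<inter> space M) \<and> G \<inter> S \<subseteq> fst ` E k" for k
  proof -
    let ?N = "\<lambda>n. {\<omega> \<in> space M. dist (b n \<omega>) \<beta> > inverse (real (Suc k))}"
    have "(\<lambda>n. prob (?N n)) \<longlonglongrightarrow> 0"
      using consistent by (auto simp: tendsto_in_prob_def)
    then have "eventually (\<lambda>n. prob (?N n) < c) sequentially"
      using \<open>c > 0\<close> by (rule order_tendstoD)
    then obtain n where n: "prob (?N n) < c" "2 * c \<le> prob (?D n)"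
      using far by (auto simp: eventually_sequentially)
    define Z where "Z \<omega> = (X n \<omega>, b n \<omega>)" for \<omega>
    have Z: "Z \<in> M \<rightarrow>\<^sub>M ?R \<Otimes>\<^sub>M borel" "Z \<in> borel_measurable M"
      unfolding Z_def by (auto intro: measurable_Pair borel_measurable_Pair)
    have "?D n \<subseteq> (Z -` E k \<inter> space M) \<union> ?N n"
      by (auto simp: Z_def E_def space_pair_measure space_restrict_space X_in)
    then have "prob (?D n) \<le> prob ((Z -` E k \<inter> space M) \<union> ?N n)"
      using measurable_sets[OF Z(1) E] by (intro finite_measure_mono sets.Un) auto
    also have "\<dots> \<le> prob (Z -` E k \<inter> space M) + prob (?N n)"
      using measurable_sets[OF Z(1) E] by (intro measure_Un_le) auto
    finally have *: "c < prob (Z -` E k \<inter> space M)"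
      using n by simp
    obtain B where B: "B \<in> sets borel" "E k = B \<inter> S \<times> UNIV"
      using sets_pair_restrict_borel_extend[OF E] .
    \<comment> \<open>Contexts lie in \<open>S\<close> at every sample point, so passing from
      \<open>E k\<close> to \<open>B\<close> does not change the event.\<close>
    have "Z -` E k \<inter> space M = Z -` B \<inter> space M"
      using B X_in by (auto simp: Z_def)
    then have "c < measure (distr M borel Z) B"
      using * B Z(2) by (simp add: measure_distr)
    moreover have "finite_measure (distr M borel Z)"
      using Z(2) by (intro finite_measure_distr)
    ultimately obtain F where F: "F \<subseteq> B" "compact F" "c < measure (distr M borel Z) F"
      using B(1) inner_regular_measure[of "distr M borel Z" B c] by auto
    have G: "fst ` F \<in> sets borel"
      using F(2) by (intro borel_compact compact_continuous_image continuous_intros)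
    have "c \<le> prob (Z -` F \<inter> space M)"
      using F Z(2) by (simp add: measure_distr borel_compact)
    also have "\<dots> \<le> prob (X n -` (fst ` F) \<inter> space M)"
      using measurable_sets[OF X_borel G] by (intro finite_measure_mono) (auto simp: Z_def rev_image_eqI)
    finally have "c \<le> prob (X n -` (fst ` F) \<inter> space M)" .
    \<comment> \<open>The compact set may leave \<open>S \<times> UNIV\<close>; only its points over
      \<open>S\<close> are known to lie in \<open>E k\<close>.\<close>
    moreover have "fst ` F \<inter> S \<subseteq> fst ` E k"
      using F(1) B(2) by force
    ultimately show ?thesis
      using G by blast
  qed
  then obtain G r where G: "\<And>k. G k \<in> sets borel"
    and G_mass: "\<And>k. c \<le> prob (X (r k) -` G k \<inter> space M)"
    and G_sub: "\<And>k. G k \<inter> S \<subseteq> fst ` E k"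
    by metis
  \<comment> \<open>Equality of the context laws moves all events to the single variable
    \<open>X 0\<close>, so that their limsup can be formed. These laws live on the trace of
    \<open>S\<close>, hence the detour through \<open>G k \<inter> S\<close>.\<close>
  have "c \<le> prob (X 0 -` G k \<inter> space M)" for k
  proof -
    have vimage: "X n -` G k \<inter> space M = X n -` (G k \<inter> S) \<inter> space M" for n
      using X_in by auto
    have GS: "G k \<inter> S \<in> sets ?R"
      using G by (auto simp: sets_restrict_space)
    show ?thesis
      using G_mass[of k] measure_distr[OF X GS, of "r k"] measure_distr[OF X GS, of 0]
      unfolding vimage distr_X[of "r k"] by simp
  qed
  then have "c \<le> prob (\<Inter>m. \<Union>k\<in>{m..}. X 0 -` G k \<inter> space M)"
    using measurable_sets[OF X_borel G] by (intro measure_limsup_ge) auto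
  \<comment> \<open>In the limsup, \<open>X 0 \<omega>\<close> lies in \<open>G k\<close> for
    arbitrarily large \<open>k\<close>. This yields a parameter within \<delta> of \<beta> at which
    \<open>f\<close> jumps by more than \<epsilon>, against continuity.\<close>
  moreover have "AE \<omega> in M. \<omega> \<notin> (\<Inter>m. \<Union>k\<in>{m..}. X 0 -` G k \<inter> space M)"
    using cont
  proof (rule AE_mp, intro AE_I2 impI notI)
    fix \<omega> assume \<omega>: "\<omega> \<in> space M" and "isCont (f (X 0 \<omega>)) \<beta>"
      and limsup: "\<omega> \<in> (\<Inter>m. \<Union>k\<in>{m..}. X 0 -` G k \<inter> space M)"
    then obtain \<delta> where "\<delta> > 0"
      and \<delta>: "\<And>y. dist y \<beta> < \<delta> \<Longrightarrow> norm (f (X 0 \<omega>) y - f (X 0 \<omega>) \<beta>) < \<epsilon>"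
      using \<open>\<epsilon> > 0\<close> unfolding continuous_at_eps_delta dist_norm by blast
    obtain m where m: "inverse (real (Suc m)) < \<delta>"
      using reals_Archimedean[OF \<open>\<delta> > 0\<close>] by auto
    obtain k where "k \<ge> m" "X 0 \<omega> \<in> G k"
      using limsup by auto
    then obtain y where y: "(X 0 \<omega>, y) \<in> E k"
      using G_sub[of k] X_in[OF \<omega>, of 0] by force
    then have "dist y \<beta> \<le> inverse (real (Suc k))"
      by (simp add: E_def)
    also have "\<dots> \<le> inverse (real (Suc m))"
      using \<open>k \<ge> m\<close> by (simp add: le_imp_inverse_le)
    finally show False
      using \<delta>[of y] m y by (simp add: E_def)
  qed
  then have "prob (\<Inter>m. \<Union>k\<in>{m..}. X 0 -` G k \<inter> space M) = 0"
    using measurable_sets[OF X_borel G, of 0]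
    by (subst prob_eq_0) (auto simp del: INT_simps UN_simps intro!: sets.countable_INT'' sets.countable_UN')
  ultimately show False
    using \<open>c > 0\<close> by simp
qed

context contextual_bandit
begin

lemma tuple_measurable: "t \<ge> 1 \<Longrightarrow> tuple K X Y t \<in> M \<rightarrow>\<^sub>M tuple_space \<X> K"
  using tuples_indep by (auto simp: indep_vars_def)

lemma context_measurable:
  assumes "t \<ge> 1"
  shows "X t \<in> M \<rightarrow>\<^sub>M context_space \<X>"
proof -
  have "(\<lambda>\<omega>. fst (tuple K X Y t \<omega>)) \<in> M \<rightarrow>\<^sub>M context_space \<X>"
    using tuple_measurable[OF assms] unfolding tuple_space_def by measurable
  then show ?thesis
    by (simp add: tuple_def)
qed

lemma context_distr:
  assumes "t \<ge> 1"
  shows "distr M (context_space \<X>) (X t) = distr M (context_space \<X>) (X 1)"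
proof -
  have fst: "fst \<in> tuple_space \<X> K \<rightarrow>\<^sub>M context_space \<X>"
    unfolding tuple_space_def by measurable
  have "distr M (context_space \<X>) (X s)
      = distr (distr M (tuple_space \<X> K) (tuple K X Y s)) (context_space \<X>) fst" if "s \<ge> 1" for s
    by (simp add: distr_distr[OF fst tuple_measurable[OF that]] comp_def tuple_def)
  then show ?thesis
    using tuples_identically_distributed[OF assms] assms by simp
qed

lemma potential_outcome_measurable:
  assumes "t \<ge> 1" "a \<in> {1..K}"
  shows "Y t a \<in> borel_measurable M"
proof -
  have "(\<lambda>\<omega>. snd (tuple K X Y t \<omega>) a) \<in> borel_measurable M"
    using measurable_compose[OF measurable_compose[OF
        tuple_measurable[OF assms(1), unfolded tuple_space_def] measurable_snd]
        measurable_component_singleton[OF assms(2)]] .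
  then show ?thesis
    using assms(2) by (simp add: tuple_def)
qed

text \<open>The action takes finitely many values, so the outcome is glued from finitely many
  measurable potential outcomes.\<close>

lemma observed_outcome_measurable:
  assumes "t \<ge> 1"
  shows "observed_outcome Y A t \<in> borel_measurable M"
  unfolding observed_outcome_def[abs_def]
proof (rule measurable_compose_countable'[OF _ action_measurable[OF assms]])
  show "(\<lambda>\<omega>. Y t a \<omega>) \<in> borel_measurable M" if "a \<in> {1..K}" for a
    using potential_outcome_measurable[OF assms that] .
qed auto

lemma sets_vimage_algebra_subset:
  "g \<in> M \<rightarrow>\<^sub>M N \<Longrightarrow> sets (vimage_algebra (space M) g N) \<subseteq> sets M"
  by (simp add: measurable_iff_sets)

text \<open>This makes history-measurable estimators random variables on \<open>M\<close>. Strong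
  induction is used because the kernel of round \<tau> is measurable only relative to the history up
  to \<open>\<tau> - 1\<close>, which must first be known to lie in \<open>M\<close>.\<close>

lemma subalgebra_history: "subalgebra M (history M \<X> K X Y A \<pi>\<^sub>b s)"
proof (induction s rule: less_induct)
  case (less s)
  have pmf: "(\<lambda>\<omega>. pmf (\<pi>\<^sub>b \<tau> \<omega> x) a) \<in> borel_measurable M"
    if "\<tau> \<in> {1..s}" "x \<in> \<X>" "a \<in> {1..K}" for \<tau> x a
  proof -
    let ?H = "history M \<X> K X Y A \<pi>\<^sub>b (\<tau> - 1)"
    \<comment> \<open>Freezing the context turns joint measurability of the kernel into
      measurability in \<omega>.\<close>
    have "(\<lambda>\<omega>. (\<omega>, x)) \<in> ?H \<rightarrow>\<^sub>M ?H \<Otimes>\<^sub>M context_space \<X>"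
      using that by (intro measurable_Pair2') (auto simp: context_space_def space_restrict_space)
    from measurable_compose[OF this behavior_policy_depends_on_history]
    have "(\<lambda>\<omega>. pmf (\<pi>\<^sub>b \<tau> \<omega> x) a) \<in> borel_measurable ?H"
      using that by simp
    then show ?thesis
      using that by (intro measurable_from_subalg[OF less.IH[of "\<tau> - 1"]]) auto
  qed
  let ?G = "\<Union>\<tau>\<in>{1..s}.
      sets (vimage_algebra (space M) (X \<tau>) (context_space \<X>))
    \<union> (\<Union>x\<in>\<X>. \<Union>a\<in>{1..K}. sets (vimage_algebra (space M) (\<lambda>\<omega>. pmf (\<pi>\<^sub>b \<tau> \<omega> x) a) borel))
    \<union> sets (vimage_algebra (space M) (A \<tau>) (count_space {1..K}))
    \<union> sets (vimage_algebra (space M) (observed_outcome Y A \<tau>) borel)"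
  have G: "?G \<subseteq> sets M"
    by (intro UN_least Un_least sets_vimage_algebra_subset context_measurable pmf
        action_measurable observed_outcome_measurable) auto
  then have "?G \<subseteq> Pow (space M)"
    using sets.space_closed by blast
  with G show ?case
    unfolding subalgebra_def history_def
    by (simp add: sets.sigma_sets_subset)
qed

end

theorem theorem4p1:
  fixes M :: "'w measure"
    and \<X> :: "(real ^ 'dx) set"
    and K :: nat
    and X :: "nat \<Rightarrow> 'w \<Rightarrow> real ^ 'dx"
    and Y :: "nat \<Rightarrow> nat \<Rightarrow> 'w \<Rightarrow> real"
    and A :: "nat \<Rightarrow> 'w \<Rightarrow> nat"
    and \<pi>\<^sub>b :: "nat \<Rightarrow> 'w \<Rightarrow> real ^ 'dx \<Rightarrow> nat pmf"
    and \<pi> :: "real ^ 'dx \<Rightarrow> real ^ 'db \<Rightarrow> nat pmf"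
    and \<beta>hat :: "nat \<Rightarrow> 'w \<Rightarrow> real ^ 'db"
    and \<beta>star :: "real ^ 'db"
    and a :: nat
  assumes bandit: "contextual_bandit M \<X> K X Y A \<pi>\<^sub>b"
    and policy: "parametric_policy \<X> K \<pi>"
    and estimator: "\<And>t. t \<ge> 1 \<Longrightarrow>
          \<beta>hat (t - 1) \<in> borel_measurable (history M \<X> K X Y A \<pi>\<^sub>b (t - 1))"
    and form: "\<And>t \<omega>. t \<ge> 1 \<Longrightarrow> \<omega> \<in> space M \<Longrightarrow>
          \<pi>\<^sub>b t \<omega> (X t \<omega>) = \<pi> (X t \<omega>) (\<beta>hat (t - 1) \<omega>)"
    and action: "a \<in> {1..K}"
    and consistent: "tendsto_in_prob M \<beta>hat (\<lambda>_. \<beta>star)"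
    and continuous: "\<And>t. t \<ge> 1 \<Longrightarrow>
          AE x in distr M (context_space \<X>) (X t). isCont (\<lambda>\<beta>. pmf (\<pi> x \<beta>) a) \<beta>star"
  shows "behavior_policy_converges_at M X \<pi>\<^sub>b a (\<lambda>x. \<pi> x \<beta>star)"
proof -
  interpret contextual_bandit M \<X> K X Y A \<pi>\<^sub>b by fact
  let ?f = "\<lambda>x \<beta>. pmf (\<pi> x \<beta>) a"
  \<comment> \<open>Index \<open>n\<close> pairs the estimate after \<open>n\<close> rounds with the
    context of round \<open>n + 1\<close>; the shift also avoids the unconstrained
    \<open>X 0\<close>.\<close>
  have lim: "tendsto_in_prob M
    (\<lambda>n \<omega>. ?f (X (Suc n) \<omega>) (\<beta>hat n \<omega>) - ?f (X (Suc n) \<omega>) \<beta>star) (\<lambda>_. 0)"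
  proof (rule tendsto_in_prob_isCont)
    show "X (Suc n) \<in> M \<rightarrow>\<^sub>M restrict_space borel \<X>" for n
      using context_measurable[of "Suc n"] by (simp add: context_space_def)
    show "distr M (restrict_space borel \<X>) (X (Suc n)) = distr M (restrict_space borel \<X>) (X (Suc 0))" for n
      using context_distr[of "Suc n"] by (simp add: context_space_def)
    show "\<beta>hat n \<in> borel_measurable M" for n
      using measurable_from_subalg[OF subalgebra_history estimator[of "Suc n"]] by simp
    show "(\<lambda>(x, \<beta>). ?f x \<beta>) \<in> borel_measurable (restrict_space borel \<X> \<Otimes>\<^sub>M borel)"
      using policy action by (simp add: parametric_policy_def context_space_def)
    show "AE \<omega> in M. isCont (?f (X (Suc 0) \<omega>)) \<beta>star"
      using AE_distrD[OF context_measurable continuous[of 1]] by simp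
  qed (fact consistent)
  show ?thesis
    unfolding behavior_policy_converges_at_def tendsto_in_prob_def
  proof (intro allI impI)
    fix \<epsilon> :: real assume "\<epsilon> > 0"
    show "(\<lambda>t. prob {\<omega> \<in> space M. dist (pmf (\<pi>\<^sub>b t \<omega> (X t \<omega>)) a - ?f (X t \<omega>) \<beta>star) 0 > \<epsilon>}) \<longlonglongrightarrow> 0"
      \<comment> \<open>Dropping the term at 0 leaves the limit unchanged and restricts to rounds
        covered by \<open>form\<close>; \<open>conj_cong\<close> supplies its premise that \<omega>
        lies in \<open>space M\<close>.\<close>
      using lim \<open>\<epsilon> > 0\<close>
      by (subst filterlim_sequentially_Suc[symmetric])
         (simp add: tendsto_in_prob_def form cong: conj_cong)
  qed
qed

end
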